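(* Let $\mathcal{H}$ be a separable complex Hilbert space. Suppose that the family $\{T(t)\}_{t\in\mathbb{R}}$ of closed, densely defined operators in $\mathcal{H}$ is weakly measurable. Assume in addition that the associated maximally defined operator $\boldsymbol{\mathcal{T}}$ in $L^2(\mathbb{R};\mathcal{H})$ is densely defined in $L^2(\mathbb{R};\mathcal{H})$. Then the family of adjoints $\{T(t)^*\}_{t\in\mathbb{R}}$ is weakly measurable.
   Context: The scalar product $(\cdot,\cdot)_{\mathcal{H}}$ is linear in the second argument. A family of vectors $\{g(t)\}_{t\in\mathbb{R}}\subset\mathcal{H}$ is called weakly measurable if $t\mapsto (h,g(t))_{\mathcal{H}}$ is Lebesgue measurable for every $h\in\mathcal{H}$. A family $\{T(t)\}_{t\in\mathbb{R}}$ of densely defined, closed, linear operators in $\mathcal{H}$ is called weakly measurable if for every weakly measurable family of vectors $\{f(t)\}_{t\in\mathbb{R}}$ in $\mathcal{H}$ with $f(t)\in\operatorname{dom}(T(t))$ for all $t\in\mathbb{R}$, the family of vectors $\{T(t)f(t)\}_{t\in\mathbb{R}}$ is weakly measurable. $L^2(\mathbb{R};\mathcal{H})$ is the Hilbert space of (a.e. equivalence classes of) weakly Lebesgue measurable functions $f:\mathbb{R}\to\mathcal{H}$ with $\int_{\mathbb{R}}\|f(t)\|_{\mathcal{H}}^2\,dt<\infty$. The operator $\boldsymbol{\mathcal{T}}$ in $L^2(\mathbb{R};\mathcal{H})$ associated with $\{T(t)\}_{t\in\mathbb{R}}$ is maximally defined by $(\boldsymbol{\mathcal{T}}f)(t)=T(t)f(t)$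 for a.e. $t\in\mathbb{R}$, with $$\operatorname{dom}(\boldsymbol{\mathcal{T}})=\Big\{g\in L^2(\mathbb{R};\mathcal{H})\,\Big|\, g(t)\in\operatorname{dom}(T(t))\text{ for a.e. }t\in\mathbb{R},\ t\mapsto T(t)g(t)\text{ is weakly measurable},\ \int_{\mathbb{R}}\|T(t)g(t)\|_{\mathcal{H}}^2\,dt<\infty\Big\}.$$ *)

theory Defs
  imports "HOL-Analysis.Analysis"
begin

section \<open>Separable complex Hilbert spaces\<close>

text \<open>
  A complex inner product space is a complex vector space with a sesquilinear form that is
  linear in the second argument. It is built on top of \<open>real_inner\<close> for its underlying
  real inner product space, whose inner product is the real part of the complex one; so
  positive definiteness, the norm \<open>norm x = sqrt (Re (cinner x x))\<close> and the norm topology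
  are inherited.
\<close>

class complex_inner = real_inner +
  fixes scaleC :: "complex \<Rightarrow> 'a \<Rightarrow> 'a"  (infixr "*\<^sub>C" 75)
    and cinner :: "'a \<Rightarrow> 'a \<Rightarrow> complex"
  assumes scaleR_eq_scaleC: "scaleR r x = scaleC (complex_of_real r) x"
    and scaleC_add_right: "scaleC c (x + y) = scaleC c x + scaleC c y"
    and scaleC_add_left: "scaleC (c + d) x = scaleC c x + scaleC d x"
    and scaleC_scaleC: "scaleC c (scaleC d x) = scaleC (c * d) x"
    and cinner_commute: "cinner x y = cnj (cinner y x)"
    and cinner_add_right: "cinner x (y + z) = cinner x y + cinner x z"
    and cinner_scaleC_right: "cinner x (scaleC c y) = c * cinner x y"
    and inner_eq_Re_cinner: "inner x y = Re (cinner x y)"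

class separable_chilbert_space = complex_inner + complete_space +
  assumes separable: "\<exists>D. countable D \<and> (\<forall>x. \<forall>e>0. \<exists>d\<in>D. dist d x < e)"

lemma ex_countable_dense:
  "\<exists>D::'a::separable_chilbert_space set. countable D \<and> closure D = UNIV"
  using separable by (auto simp: set_eq_iff closure_approachable)

instance separable_chilbert_space \<subseteq> second_countable_topology
proof
  obtain D :: "'a set" where D: "countable D" "closure D = UNIV"
    using ex_countable_dense by blast
  define B where "B = (\<lambda>(d, q). ball d q) ` (D \<times> (\<rat>::real set))"
  have cB: "countable B"
    unfolding B_def using D(1) countable_rat by (intro countable_image countable_SIGMA) auto
  have "topological_basis B"
  proof (rule topological_basisI)
    show "open b" if "b \<in> B" for b
      using that by (auto simp: B_def)
  next
    fix U :: "'a set" and x assume U: "open U" "x \<in> U"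
    then obtain e where e: "e > 0" "ball x e \<subseteq> U"
      by (meson openE)
    obtain q :: real where q: "q \<in> \<rat>" "0 < q" "q < e / 2"
      using Rats_dense_in_real[of 0 "e / 2"] e(1) by auto
    have "x \<in> closure D" using D(2) by simp
    then obtain d where d: "d \<in> D" "dist d x < q"
      using q(2) unfolding closure_approachable by blast
    have "ball d q \<subseteq> U"
    proof
      fix z assume "z \<in> ball d q"
      then have "dist x z < q + q"
        using d(2) dist_triangle[of x z d] by (simp add: dist_commute)
      then show "z \<in> U" using q(3) e(2) by auto
    qed
    then show "\<exists>V\<in>B. x \<in> V \<and> V \<subseteq> U"
      using d q(1) by (intro bexI[of _ "ball d q"]) (auto simp: B_def)
  qed
  then show "\<exists>B::'a set set. countable B \<and> open = generate_topology B"
    using cB topological_basis_imp_subbasis by blast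
qed

lemma scaleC_one: "scaleC 1 x = x"
  using scaleR_eq_scaleC[of 1 x] by simp

lemma cinner_add_left: "cinner (x + y) z = cinner x z + cinner y z"
  by (metis cinner_add_right cinner_commute complex_cnj_add)

lemma cinner_scaleC_left: "cinner (scaleC c x) y = cnj c * cinner x y"
  by (metis cinner_scaleC_right cinner_commute complex_cnj_mult)

lemma cinner_self: "cinner x x = complex_of_real ((norm x)\<^sup>2)"
proof -
  have "Im (cinner x x) = 0"
    using arg_cong[OF cinner_commute[of x x], of Im] by simp
  then show ?thesis
    using inner_eq_Re_cinner[of x x] by (simp add: complex_eq_iff power2_norm_eq_inner)
qed

lemma norm_scaleC: "norm (scaleC c x) = cmod c * norm x"
proof -
  have "complex_of_real ((norm (scaleC c x))\<^sup>2) = c * cnj c * complex_of_real ((norm x)\<^sup>2)"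
    unfolding cinner_self[symmetric] by (simp add: cinner_scaleC_left cinner_scaleC_right)
  also have "\<dots> = complex_of_real ((cmod c * norm x)\<^sup>2)"
    by (simp add: complex_norm_square[symmetric] power_mult_distrib)
  finally have "(norm (scaleC c x))\<^sup>2 = (cmod c * norm x)\<^sup>2"
    using of_real_eq_iff by blast
  then show ?thesis by (simp add: power2_eq_iff_nonneg)
qed

lemma cinner_eq_inner: "cinner x y = Complex (inner x y) (inner x (scaleC (- \<i>) y))"
  by (simp add: complex_eq_iff inner_eq_Re_cinner cinner_scaleC_right)

lemma norm_cinner_le: "cmod (cinner x y) \<le> norm x * norm y"
proof (cases "cinner x y = 0")
  case False
  define u where "u = cnj (cinner x y) / complex_of_real (cmod (cinner x y))"
  have u: "cmod u = 1" using False by (simp add: u_def norm_divide)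
  have "u * cinner x y = complex_of_real (cmod (cinner x y))"
    using False by (simp add: u_def complex_norm_square[symmetric] power2_eq_square mult.commute)
  then have "inner x (scaleC u y) = cmod (cinner x y)"
    by (simp add: inner_eq_Re_cinner cinner_scaleC_right)
  then show ?thesis
    using norm_cauchy_schwarz[of x "scaleC u y"] u by (simp add: norm_scaleC)
qed simp

section \<open>Partial operators\<close>

text \<open>
  An operator in \<open>X\<close> is a partial map, with domain \<open>dom A\<close>, graph \<open>Map.graph A\<close>,
  and value \<open>the (A x)\<close> at \<open>x \<in> dom A\<close>.
\<close>

definition linear_operator :: "('a::complex_inner \<rightharpoonup> 'a) \<Rightarrow> bool" where
  "linear_operator A \<longleftrightarrow>
     0 \<in> dom A \<and>
     (\<forall>x\<in>dom A. \<forall>y\<in>dom A. A (x + y) = Some (the (A x) + the (A y))) \<and>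
     (\<forall>c. \<forall>x\<in>dom A. A (c *\<^sub>C x) = Some (c *\<^sub>C the (A x)))"

definition densely_defined :: "('a::topological_space \<rightharpoonup> 'a) \<Rightarrow> bool" where
  "densely_defined A \<longleftrightarrow> closure (dom A) = UNIV"

definition closed_operator :: "('a::topological_space \<rightharpoonup> 'a) \<Rightarrow> bool" where
  "closed_operator A \<longleftrightarrow> closed (Map.graph A)"

text \<open>
  For densely defined \<open>A\<close> the vector \<open>z\<close> below is unique. For other \<open>A\<close>
  the adjoint is a junk value.
\<close>

definition op_adjoint :: "('a::complex_inner \<rightharpoonup> 'a) \<Rightarrow> ('a \<rightharpoonup> 'a)" where
  "op_adjoint A = (\<lambda>y.
     if \<exists>z. \<forall>x\<in>dom A. cinner y (the (A x)) = cinner z x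
     then Some (THE z. \<forall>x\<in>dom A. cinner y (the (A x)) = cinner z x)
     else None)"

section \<open>Weak measurability\<close>

definition weakly_measurable :: "(real \<Rightarrow> 'a::complex_inner) \<Rightarrow> bool" where
  "weakly_measurable g \<longleftrightarrow> (\<forall>h. (\<lambda>t. cinner h (g t)) \<in> borel_measurable lebesgue)"

text \<open>
  Weak measurability is a notion for families of closed, densely defined, linear operators,
  hence these requirements are part of the definition.
\<close>

definition weakly_measurable_family :: "(real \<Rightarrow> 'a::complex_inner \<rightharpoonup> 'a) \<Rightarrow> bool" where
  "weakly_measurable_family T \<longleftrightarrow>
     (\<forall>t. linear_operator (T t) \<and> densely_defined (T t) \<and> closed_operator (T t)) \<and>
     (\<forall>f. weakly_measurable f \<and> (\<forall>t. f t \<in> dom (T t)) \<longrightarrow>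
          weakly_measurable (\<lambda>t. the (T t (f t))))"

section \<open>The space of square integrable functions\<close>

definition square_integrable :: "(real \<Rightarrow> 'a::complex_inner) \<Rightarrow> bool" where
  "square_integrable f \<longleftrightarrow> weakly_measurable f \<and> integrable lebesgue (\<lambda>t. (norm (f t))\<^sup>2)"

lemma weakly_measurable_add:
  "weakly_measurable f \<Longrightarrow> weakly_measurable g \<Longrightarrow> weakly_measurable (\<lambda>t. f t + g t)"
  by (simp add: weakly_measurable_def cinner_add_right borel_measurable_add)

lemma weakly_measurable_scaleC: "weakly_measurable f \<Longrightarrow> weakly_measurable (\<lambda>t. c *\<^sub>C f t)"
  by (simp add: weakly_measurable_def cinner_scaleC_right borel_measurable_times)

lemma weakly_measurable_const: "weakly_measurable (\<lambda>t. c)"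
  by (simp add: weakly_measurable_def)

lemma uminus_eq_scaleC: "- x = (- 1) *\<^sub>C (x::'a::complex_inner)"
  using scaleR_eq_scaleC[of "- 1" x] by simp

lemma weakly_measurable_imp_measurable:
  fixes f :: "real \<Rightarrow> 'a::separable_chilbert_space"
  assumes f: "weakly_measurable f"
  shows "f \<in> borel_measurable lebesgue"
proof (rule borel_measurableI)
  fix U :: "'a set" assume U: "open U"
  obtain D :: "'a set" where D: "countable D" "closure D = UNIV"
    using ex_countable_dense by blast
  have norm_le_iff: "norm x \<le> r \<longleftrightarrow> (\<forall>d\<in>D. \<bar>inner d x\<bar> \<le> norm d * r)"
    if "0 \<le> r" for x :: 'a and r
  proof
    assume "norm x \<le> r"
    then show "\<forall>d\<in>D. \<bar>inner d x\<bar> \<le> norm d * r"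
      using Cauchy_Schwarz_ineq2 by (meson mult_left_mono norm_ge_zero order_trans)
  next
    assume le: "\<forall>d\<in>D. \<bar>inner d x\<bar> \<le> norm d * r"
    have "closed {d. \<bar>inner d x\<bar> \<le> norm d * r}"
      by (intro closed_Collect_le continuous_intros)
    then have "closure D \<subseteq> {d. \<bar>inner d x\<bar> \<le> norm d * r}"
      using le by (intro closure_minimal) auto
    then have all: "\<bar>inner d x\<bar> \<le> norm d * r" for d using D(2) by auto
    from all[of x] have "norm x * norm x \<le> norm x * r"
      by (simp add: power2_norm_eq_inner[symmetric] power2_eq_square)
    then show "norm x \<le> r"
      using that by (cases "x = 0") auto
  qed
  have inner_meas: "(\<lambda>t. inner d (f t)) \<in> borel_measurable lebesgue" for d
    using f by (simp add: weakly_measurable_def inner_eq_Re_cinner measurable_compose[OF _ borel_measurable_Re])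
  have cball_sets: "f -` cball a r \<in> sets lebesgue" if "0 \<le> r" for a r
  proof -
    have "f -` cball a r = {t\<in>space lebesgue. \<forall>d\<in>D. \<bar>inner d a - inner d (f t)\<bar> \<le> norm d * r}"
      using norm_le_iff[OF that] by (auto simp: dist_norm inner_diff_right)
    also have "\<dots> \<in> sets lebesgue"
      using D(1) inner_meas by measurable
    finally show ?thesis .
  qed
  define I where "I = {(d, q). d \<in> D \<and> q \<in> (\<rat>::real set) \<and> 0 \<le> q \<and> cball d q \<subseteq> U}"
  have "I \<subseteq> D \<times> \<rat>" by (auto simp: I_def)
  then have "countable I"
    using D(1) countable_rat by (meson countable_SIGMA countable_subset)
  have "U \<subseteq> (\<Union>(d, q)\<in>I. cball d q)"
  proof
    fix x assume "x \<in> U"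
    with U obtain e where e: "e > 0" "ball x e \<subseteq> U" by (meson openE)
    obtain q :: real where q: "q \<in> \<rat>" "0 < q" "q < e / 2"
      using Rats_dense_in_real[of 0 "e / 2"] e(1) by auto
    have "x \<in> closure D" using D(2) by simp
    then obtain d where d: "d \<in> D" "dist d x < q"
      using q(2) unfolding closure_approachable by blast
    have "cball d q \<subseteq> U"
    proof
      fix z assume "z \<in> cball d q"
      then have "dist x z < q + q"
        using d(2) dist_triangle[of x z d] by (simp add: dist_commute)
      then show "z \<in> U" using q(3) e(2) by auto
    qed
    then show "x \<in> (\<Union>(d, q)\<in>I. cball d q)"
      using d q by (intro UN_I[of "(d, q)"]) (auto simp: I_def)
  qed
  then have "U = (\<Union>(d, q)\<in>I. cball d q)" by (auto simp: I_def)
  then have "f -` U = (\<Union>(d, q)\<in>I. f -` cball d q)" by auto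
  also have "\<dots> \<in> sets lebesgue"
    using \<open>countable I\<close> cball_sets by (intro sets.countable_UN') (auto simp: I_def)
  finally show "f -` U \<inter> space lebesgue \<in> sets lebesgue" by simp
qed

lemma integrable_cinner:
  fixes f g :: "real \<Rightarrow> 'a::separable_chilbert_space"
  assumes f: "square_integrable f" and g: "square_integrable g"
  shows "integrable lebesgue (\<lambda>t. cinner (f t) (g t))"
proof (rule Bochner_Integration.integrable_bound)
  show "integrable lebesgue (\<lambda>t. (norm (f t))\<^sup>2 + (norm (g t))\<^sup>2)"
    using f g by (simp add: square_integrable_def)
  have m: "f \<in> borel_measurable lebesgue" "g \<in> borel_measurable lebesgue"
    "(\<lambda>t. (- \<i>) *\<^sub>C g t) \<in> borel_measurable lebesgue"
    using f g weakly_measurable_scaleC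
    by (auto simp: square_integrable_def intro: weakly_measurable_imp_measurable)
  have "(\<lambda>t. complex_of_real (inner (f t) (g t)) +
      \<i> * complex_of_real (inner (f t) ((- \<i>) *\<^sub>C g t))) \<in> borel_measurable lebesgue"
    using m by measurable
  then show "(\<lambda>t. cinner (f t) (g t)) \<in> borel_measurable lebesgue"
    by (simp add: cinner_eq_inner Complex_eq)
  show "AE t in lebesgue. norm (cinner (f t) (g t)) \<le> norm ((norm (f t))\<^sup>2 + (norm (g t))\<^sup>2)"
  proof (rule AE_I2)
    fix t
    have "2 * (norm (f t) * norm (g t)) \<le> (norm (f t))\<^sup>2 + (norm (g t))\<^sup>2"
      using sum_squares_bound[of "norm (f t)" "norm (g t)"] by simp
    moreover have "0 \<le> norm (f t) * norm (g t)" by simp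
    ultimately show "norm (cinner (f t) (g t)) \<le> norm ((norm (f t))\<^sup>2 + (norm (g t))\<^sup>2)"
      using norm_cinner_le[of "f t" "g t"] unfolding real_norm_def by linarith
  qed
qed

lemma integrable_inner:
  fixes f g :: "real \<Rightarrow> 'a::separable_chilbert_space"
  assumes "square_integrable f" "square_integrable g"
  shows "integrable lebesgue (\<lambda>t. inner (f t) (g t))"
  unfolding inner_eq_Re_cinner using integrable_cinner[OF assms] by (rule integrable_Re)

lemma square_integrable_0: "square_integrable (\<lambda>t. 0)"
  by (simp add: square_integrable_def weakly_measurable_const)

lemma square_integrable_scaleC: "square_integrable f \<Longrightarrow> square_integrable (\<lambda>t. c *\<^sub>C f t)"
  by (auto simp: square_integrable_def weakly_measurable_scaleC norm_scaleC power_mult_distrib)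

lemma square_integrable_add:
  fixes f g :: "real \<Rightarrow> 'a::separable_chilbert_space"
  assumes f: "square_integrable f" and g: "square_integrable g"
  shows "square_integrable (\<lambda>t. f t + g t)"
proof -
  have "integrable lebesgue (\<lambda>t. (norm (f t))\<^sup>2 + 2 * inner (f t) (g t) + (norm (g t))\<^sup>2)"
    using f g integrable_inner[OF f g] by (simp add: square_integrable_def)
  then show ?thesis
    using f g
    by (simp add: square_integrable_def weakly_measurable_add power2_norm_eq_inner
        inner_add_left inner_add_right inner_commute algebra_simps)
qed

lemma square_integrable_scaleR: "square_integrable f \<Longrightarrow> square_integrable (\<lambda>t. c *\<^sub>R f t)"
  by (simp add: scaleR_eq_scaleC square_integrable_scaleC)

lemma square_integrable_uminus: "square_integrable f \<Longrightarrow> square_integrable (\<lambda>t. - f t)"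
  by (simp add: uminus_eq_scaleC square_integrable_scaleC)

lemma square_integrable_diff:
  fixes f g :: "real \<Rightarrow> 'a::separable_chilbert_space"
  shows "square_integrable f \<Longrightarrow> square_integrable g \<Longrightarrow> square_integrable (\<lambda>t. f t - g t)"
  using square_integrable_add[of f "\<lambda>t. - g t"] by (simp add: square_integrable_uminus)

quotient_type (overloaded) 'a L2 = "real \<Rightarrow> 'a::separable_chilbert_space" / partial:
  "\<lambda>f g. square_integrable f \<and> square_integrable g \<and> (AE t in lebesgue. f t = g t)"
proof (rule part_equivpI)
  show "\<exists>f::real \<Rightarrow> 'a. square_integrable f \<and> square_integrable f \<and> (AE t in lebesgue. f t = f t)"
    using square_integrable_0 by auto
  show "symp (\<lambda>f g::real \<Rightarrow> 'a. square_integrable f \<and> square_integrable g \<and>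
      (AE t in lebesgue. f t = g t))"
    by (rule sympI) (auto elim: AE_mp)
  show "transp (\<lambda>f g::real \<Rightarrow> 'a. square_integrable f \<and> square_integrable g \<and>
      (AE t in lebesgue. f t = g t))"
    by (rule transpI) (auto elim: AE_mp)
qed

instantiation L2 :: (separable_chilbert_space) real_inner
begin

lift_definition zero_L2 :: "'a L2" is "\<lambda>t. 0"
  by (simp add: square_integrable_0)

lift_definition plus_L2 :: "'a L2 \<Rightarrow> 'a L2 \<Rightarrow> 'a L2" is "\<lambda>f g t. f t + g t"
  by (auto simp: square_integrable_add)

lift_definition minus_L2 :: "'a L2 \<Rightarrow> 'a L2 \<Rightarrow> 'a L2" is "\<lambda>f g t. f t - g t"
  by (auto simp: square_integrable_diff)

lift_definition uminus_L2 :: "'a L2 \<Rightarrow> 'a L2" is "\<lambda>f t. - f t"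
  by (auto simp: square_integrable_uminus)

lift_definition scaleR_L2 :: "real \<Rightarrow> 'a L2 \<Rightarrow> 'a L2" is "\<lambda>c f t. c *\<^sub>R f t"
  by (auto simp: square_integrable_scaleR)

lift_definition inner_L2 :: "'a L2 \<Rightarrow> 'a L2 \<Rightarrow> real" is "\<lambda>f g. \<integral>t. inner (f t) (g t) \<partial>lebesgue"
proof goal_cases
  case (1 f f' g g')
  then have "AE t in lebesgue. inner (f t) (g t) = inner (f' t) (g' t)" by auto
  with 1 show ?case
    by (intro integral_cong_AE) (auto intro: borel_measurable_integrable integrable_inner)
qed

definition norm_L2 :: "'a L2 \<Rightarrow> real" where "norm_L2 f = sqrt (inner f f)"
definition sgn_L2 :: "'a L2 \<Rightarrow> 'a L2" where "sgn_L2 f = inverse (norm f) *\<^sub>R f"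
definition dist_L2 :: "'a L2 \<Rightarrow> 'a L2 \<Rightarrow> real" where "dist_L2 f g = norm (f - g)"
definition uniformity_L2 :: "('a L2 \<times> 'a L2) filter" where
  "uniformity_L2 = (INF e\<in>{0<..}. principal {(x, y). dist x y < e})"
definition open_L2 :: "'a L2 set \<Rightarrow> bool" where
  "open_L2 U = (\<forall>x\<in>U. eventually (\<lambda>(x', y). x' = x \<longrightarrow> y \<in> U) uniformity)"

instance
proof
  fix f g h :: "'a L2" and a b :: real
  show "f + g + h = f + (g + h)"
    by transfer (auto simp: square_integrable_add add.assoc)
  show "f + g = g + f"
    by transfer (auto simp: square_integrable_add add.commute)
  show "0 + f = f"
    by transfer auto
  show "- f + f = 0"
    by transfer (auto simp: square_integrable_0)
  show "f - g = f + - g"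
    by transfer (auto simp: square_integrable_diff)
  show "a *\<^sub>R (f + g) = a *\<^sub>R f + a *\<^sub>R g"
    by transfer (auto simp: square_integrable_scaleR square_integrable_add scaleR_add_right)
  show "(a + b) *\<^sub>R f = a *\<^sub>R f + b *\<^sub>R f"
    by transfer (auto simp: square_integrable_scaleR square_integrable_add scaleR_add_left)
  show "a *\<^sub>R b *\<^sub>R f = (a * b) *\<^sub>R f"
    by transfer (auto simp: square_integrable_scaleR)
  show "1 *\<^sub>R f = f"
    by transfer auto
  show "inner f g = inner g f"
    by transfer (simp add: inner_commute)
  show "inner (f + g) h = inner f h + inner g h"
    by transfer (simp add: inner_add_left integrable_inner)
  show "inner (a *\<^sub>R f) g = a * inner f g"
    by transfer simp
  show "0 \<le> inner f f"
    by transfer simp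
  show "(inner f f = 0) = (f = 0)"
  proof transfer
    fix f :: "real \<Rightarrow> 'a"
    assume "square_integrable f \<and> square_integrable f \<and> (AE t in lebesgue. f t = f t)"
    then show "((\<integral>t. inner (f t) (f t) \<partial>lebesgue) = 0) =
        (square_integrable f \<and> square_integrable (\<lambda>t. 0::'a) \<and> (AE t in lebesgue. f t = 0))"
      using integral_nonneg_eq_0_iff_AE[OF integrable_inner[of f f]]
      by (simp add: square_integrable_0)
  qed
qed (auto simp: norm_L2_def sgn_L2_def dist_L2_def uniformity_L2_def open_L2_def)

end

instantiation L2 :: (separable_chilbert_space) complex_inner
begin

lift_definition scaleC_L2 :: "complex \<Rightarrow> 'a L2 \<Rightarrow> 'a L2" is "\<lambda>c f t. c *\<^sub>C f t"
  by (auto simp: square_integrable_scaleC)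

lift_definition cinner_L2 :: "'a L2 \<Rightarrow> 'a L2 \<Rightarrow> complex" is
  "\<lambda>f g. \<integral>t. cinner (f t) (g t) \<partial>lebesgue"
proof goal_cases
  case (1 f f' g g')
  then have "AE t in lebesgue. cinner (f t) (g t) = cinner (f' t) (g' t)" by auto
  with 1 show ?case
    by (intro integral_cong_AE) (auto intro: borel_measurable_integrable integrable_cinner)
qed

instance
proof
  fix f g h :: "'a L2" and r :: real and c d :: complex
  show "r *\<^sub>R f = complex_of_real r *\<^sub>C f"
    by transfer (auto simp: square_integrable_scaleC scaleR_eq_scaleC)
  show "c *\<^sub>C (f + g) = c *\<^sub>C f + c *\<^sub>C g"
    by transfer (auto simp: square_integrable_scaleC square_integrable_add scaleC_add_right)
  show "(c + d) *\<^sub>C f = c *\<^sub>C f + d *\<^sub>C f"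
    by transfer (auto simp: square_integrable_scaleC square_integrable_add scaleC_add_left)
  show "c *\<^sub>C d *\<^sub>C f = (c * d) *\<^sub>C f"
    by transfer (auto simp: square_integrable_scaleC scaleC_scaleC)
  show "cinner f g = cnj (cinner g f)"
    by transfer (simp flip: Bochner_Integration.integral_cnj,
        rule Bochner_Integration.integral_cong[OF refl cinner_commute])
  show "cinner f (g + h) = cinner f g + cinner f h"
    by transfer (simp add: cinner_add_right integrable_cinner)
  show "cinner f (c *\<^sub>C g) = c * cinner f g"
    by transfer (simp add: cinner_scaleC_right)
  show "inner f g = Re (cinner f g)"
    by transfer (simp add: inner_eq_Re_cinner integrable_cinner)
qed

end

text \<open>
  The maximally defined operator in \<open>L2\<close>. The representative \<open>rep_L2 g\<close> of the class
  \<open>g\<close> is an arbitrary one: the conditions and the resulting class do not depend on it,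
  nor on the values of \<open>the (T t (rep_L2 g t))\<close> on the null set where
  \<open>rep_L2 g t \<notin> dom (T t)\<close>, since Lebesgue measure is complete.
\<close>

definition maximal_operator ::
    "(real \<Rightarrow> 'a::separable_chilbert_space \<rightharpoonup> 'a) \<Rightarrow> ('a L2 \<rightharpoonup> 'a L2)" where
  "maximal_operator T = (\<lambda>g.
     if (AE t in lebesgue. rep_L2 g t \<in> dom (T t)) \<and>
        square_integrable (\<lambda>t. the (T t (rep_L2 g t)))
     then Some (abs_L2 (\<lambda>t. the (T t (rep_L2 g t))))
     else None)"

end

theory Submission
  imports Defs
begin

text \<open>
  For each fixed \<open>t\<close> the adjoint is again closed and densely defined: a vector \<open>x\<close>
  orthogonal to its domain makes \<open>(0, x)\<close> orthogonal to the orthogonal complement of the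
  closed graph of \<open>T t\<close>, so \<open>(0, x)\<close> lies in that graph and \<open>x = 0\<close>.
  For the measurability, approximate \<open>indicator {-n..n} *\<^sub>R h\<close> in \<open>L2\<close> by elements
  \<open>g k\<close> of the domain of the maximal operator, and pass to a subsequence converging almost
  everywhere. There, \<open>cinner (T\<^sup>* f) h\<close> is the limit of
  \<open>cinner (T\<^sup>* f) (g k) = cinner f (T (g k))\<close>, whose measurability is clear.
\<close>

section \<open>Orthogonal projection\<close>

lemma subspace_closure:
  fixes S :: "'a::real_normed_vector set"
  assumes "subspace S"
  shows "subspace (closure S)"
proof (rule subspaceI)
  show "0 \<in> closure S" using subspace_0[OF assms] closure_subset by blast
next
  fix x y assume "x \<in> closure S" "y \<in> closure S"
  then obtain f g where "\<And>n. f n \<in> S" "f \<longlonglongrightarrow> x" "\<And>n. g n \<in> S" "g \<longlonglongrightarrow> y"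
    unfolding closure_sequential by blast
  then show "x + y \<in> closure S"
    unfolding closure_sequential
    by (intro exI[of _ "\<lambda>n. f n + g n"]) (auto intro: tendsto_add subspace_add[OF assms])
next
  fix c x assume "x \<in> closure S"
  then obtain f where "\<And>n. f n \<in> S" "f \<longlonglongrightarrow> x"
    unfolding closure_sequential by blast
  then show "c *\<^sub>R x \<in> closure S"
    unfolding closure_sequential
    by (intro exI[of _ "\<lambda>n. c *\<^sub>R f n"])
      (auto intro: tendsto_scaleR subspace_scale[OF assms])
qed

text \<open>A minimizing sequence for the distance from \<open>x\<close> to \<open>S\<close> is
  Cauchy by the parallelogram law, and its limit is a nearest point. The real setting covers both
  uses: graphs in the product space and closures of domains.\<close>

lemma closed_subspace_projection:
  fixes S :: "'a::{real_inner,complete_space} set"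
  assumes S: "closed S" "subspace S"
  obtains p where "p \<in> S" "\<And>s. s \<in> S \<Longrightarrow> inner (x - p) s = 0"
proof -
  define D where "D = (INF s\<in>S. (norm (x - s))\<^sup>2)"
  have ne: "S \<noteq> {}" using subspace_0[OF S(2)] by auto
  have bdd: "bdd_below ((\<lambda>s. (norm (x - s))\<^sup>2) ` S)" by (rule bdd_belowI[of _ 0]) auto
  have D_le: "D \<le> (norm (x - s))\<^sup>2" if "s \<in> S" for s
    unfolding D_def by (rule cINF_lower[OF bdd that])
  have "\<exists>s\<in>S. (norm (x - s))\<^sup>2 < D + 1 / real (Suc n)" for n
    using cINF_less_iff[OF ne bdd, of "D + 1 / real (Suc n)"] by (simp add: D_def)
  then obtain s where s: "\<And>n. s n \<in> S" "\<And>n. (norm (x - s n))\<^sup>2 < D + 1 / real (Suc n)"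
    by metis
  \<comment> \<open>The midpoint lies in \<open>S\<close>, so its squared distance to
    \<open>x\<close> is at least \<open>D\<close>. In the parallelogram identity the multiples of
    \<open>D\<close> cancel and only the two error terms remain.\<close>
  have close: "(norm (s m - s n))\<^sup>2 \<le> 2 / real (Suc m) + 2 / real (Suc n)" for m n
  proof -
    have "(1/2) *\<^sub>R (s m + s n) \<in> S"
      using s(1) S(2) by (simp add: subspace_add subspace_scale)
    then have "D \<le> (norm (x - (1/2) *\<^sub>R (s m + s n)))\<^sup>2" by (rule D_le)
    moreover have "(norm (s m - s n))\<^sup>2 =
        2 * (norm (x - s m))\<^sup>2 + 2 * (norm (x - s n))\<^sup>2 - 4 * (norm (x - (1/2) *\<^sub>R (s m + s n)))\<^sup>2"
      by (simp add: power2_norm_eq_inner inner_diff_left inner_diff_right inner_add_left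
          inner_add_right inner_commute algebra_simps)
    ultimately show ?thesis using s(2)[of m] s(2)[of n] by linarith
  qed
  have "Cauchy s"
  proof (rule metric_CauchyI)
    fix e :: real assume e: "0 < e"
    \<comment> \<open>With this bound each of the two terms in \<open>close\<close> is below half of
      the square of \<open>e\<close>.\<close>
    then obtain N where N: "1 / real (Suc N) < e\<^sup>2 / 4"
      using nat_approx_posE[of "e\<^sup>2 / 4"] by auto
    show "\<exists>M. \<forall>m\<ge>M. \<forall>n\<ge>M. dist (s m) (s n) < e"
    proof (intro exI allI impI)
      fix m n assume "m \<ge> N" "n \<ge> N"
      then have "1 / real (Suc m) \<le> 1 / real (Suc N)" "1 / real (Suc n) \<le> 1 / real (Suc N)"
        by (auto intro!: divide_left_mono)
      then have "(norm (s m - s n))\<^sup>2 < e\<^sup>2" using close[of m n] N by simp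
      then show "dist (s m) (s n) < e"
        using e by (simp add: dist_norm power2_less_imp_less)
    qed
  qed
  then obtain p where p: "s \<longlonglongrightarrow> p" using Cauchy_convergent convergent_def by blast
  have pS: "p \<in> S" using closed_sequentially[OF S(1)] s(1) p by blast
  have "(\<lambda>n. (norm (x - s n))\<^sup>2) \<longlonglongrightarrow> (norm (x - p))\<^sup>2" by (intro tendsto_intros p)
  moreover have "(\<lambda>n. D + 1 / real (Suc n)) \<longlonglongrightarrow> D + 0"
    by (intro tendsto_intros LIMSEQ_Suc[OF lim_1_over_n])
  ultimately have p_le: "(norm (x - p))\<^sup>2 \<le> D"
    using s(2) by (intro LIMSEQ_le[where Y = "\<lambda>n. D + 1 / real (Suc n)"]) (auto intro: less_imp_le)
  have "inner (x - p) y = 0" if y: "y \<in> S" for y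
  proof (cases "y = 0")
    case False
    \<comment> \<open>This \<open>c\<close> minimizes the norm of
      \<open>(x - p) - c *\<^sub>R y\<close>. As \<open>p\<close> is already nearest, the gain, a
      square, must vanish.\<close>
    define c where "c = inner (x - p) y / (norm y)\<^sup>2"
    have "p + c *\<^sub>R y \<in> S" using pS y S(2) by (simp add: subspace_add subspace_scale)
    then have "(norm (x - p))\<^sup>2 \<le> (norm ((x - p) - c *\<^sub>R y))\<^sup>2"
      using D_le[of "p + c *\<^sub>R y"] p_le unfolding diff_diff_add by linarith
    also have "\<dots> = (norm (x - p))\<^sup>2 - 2 * c * inner (x - p) y + c\<^sup>2 * (norm y)\<^sup>2"
      unfolding power2_norm_eq_inner inner_diff_left[of "x - p"] inner_diff_right[of _ "x - p"]
      by (simp add: inner_commute power2_eq_square)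
    also have "\<dots> = (norm (x - p))\<^sup>2 - (inner (x - p) y)\<^sup>2 / (norm y)\<^sup>2"
      using False by (simp add: c_def field_simps power2_eq_square)
    finally have "(inner (x - p) y)\<^sup>2 / (norm y)\<^sup>2 \<le> 0" by simp
    then show ?thesis using False by (simp add: divide_le_0_iff)
  qed simp
  with pS show thesis by (rule that)
qed

section \<open>Adjoints of densely defined operators\<close>

lemma cinner_zero_left [simp]: "cinner 0 x = 0"
  using cinner_add_left[of 0 0 x] by simp

lemma cinner_zero_right [simp]: "cinner x 0 = 0"
  using cinner_add_right[of x 0 0] by simp

lemma cinner_minus_left: "cinner (- x) y = - cinner x y"
  by (simp add: uminus_eq_scaleC cinner_scaleC_left)

lemma cinner_diff_left: "cinner (x - y) z = cinner x z - cinner y z"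
  using cinner_add_left[of x "- y" z] by (simp add: cinner_minus_left)

lemma continuous_cinner_left: "continuous_on A (\<lambda>x. cinner x y)"
  unfolding cinner_eq_inner Complex_eq by (intro continuous_intros)

lemma continuous_cinner_right: "continuous_on A (\<lambda>x. cinner y x)"
  by (subst cinner_commute) (intro continuous_intros continuous_cinner_left)

text \<open>Two candidates for the adjoint value differ by a vector orthogonal to
  \<open>dom A\<close>, hence by density to everything, itself included. This uniqueness eliminates
  the \<open>THE\<close> for all later arguments.\<close>

lemma op_adjoint_eq_Some_iff:
  assumes "densely_defined A"
  shows "op_adjoint A y = Some z \<longleftrightarrow> (\<forall>x\<in>dom A. cinner y (the (A x)) = cinner z x)"
proof -
  have uniq: "z = w" if zw: "\<forall>x\<in>dom A. cinner y (the (A x)) = cinner z x"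
    "\<forall>x\<in>dom A. cinner y (the (A x)) = cinner w x" for z w
  proof -
    have "closed {x. cinner (z - w) x = 0}"
      by (intro closed_Collect_eq continuous_cinner_right continuous_intros)
    moreover have "dom A \<subseteq> {x. cinner (z - w) x = 0}"
      using zw by (simp add: cinner_diff_left subset_iff)
    ultimately have "closure (dom A) \<subseteq> {x. cinner (z - w) x = 0}"
      by (rule closure_minimal[rotated])
    then have "cinner (z - w) (z - w) = 0"
      using assms by (auto simp: densely_defined_def)
    then show ?thesis by (simp add: cinner_self)
  qed
  show ?thesis
  proof (cases "\<exists>z. \<forall>x\<in>dom A. cinner y (the (A x)) = cinner z x")
    case True
    then have "\<exists>!z. \<forall>x\<in>dom A. cinner y (the (A x)) = cinner z x" using uniq by blast
    from theI'[OF this] show ?thesis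
      using True uniq unfolding op_adjoint_def by auto
  qed (auto simp: op_adjoint_def)
qed

lemma cinner_op_adjoint:
  assumes "densely_defined A" "y \<in> dom (op_adjoint A)" "x \<in> dom A"
  shows "cinner (the (op_adjoint A y)) x = cinner y (the (A x))"
  using assms op_adjoint_eq_Some_iff[of A y "the (op_adjoint A y)"] by (metis domD option.sel)

lemma linear_operator_op_adjoint:
  assumes "densely_defined A"
  shows "linear_operator (op_adjoint A)"
  unfolding linear_operator_def
proof (intro conjI ballI allI)
  have "op_adjoint A 0 = Some 0" by (simp add: op_adjoint_eq_Some_iff[OF assms])
  then show "0 \<in> dom (op_adjoint A)" by (rule domI)
qed (simp_all add: op_adjoint_eq_Some_iff[OF assms] cinner_op_adjoint[OF assms]
    cinner_add_left cinner_scaleC_left)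

text \<open>Each \<open>x\<close> in \<open>dom A\<close> imposes on pairs a condition that equates
  two continuous functions, so the graph is an intersection of closed sets.\<close>

lemma closed_operator_op_adjoint:
  assumes "densely_defined A"
  shows "closed_operator (op_adjoint A)"
proof -
  have "Map.graph (op_adjoint A) =
      (\<Inter>x\<in>dom A. {p. cinner (fst p) (the (A x)) = cinner (snd p) x})"
    by (simp add: set_eq_iff Map.graph_def op_adjoint_eq_Some_iff[OF assms])
  also have "closed \<dots>"
    by (intro closed_INT ballI closed_Collect_eq
        continuous_on_compose2[OF continuous_cinner_left[of UNIV]] continuous_intros) auto
  finally show ?thesis by (simp add: closed_operator_def)
qed

text \<open>Complex linearity is weakened to a real \<open>subspace\<close>, the form that
  \<open>closed_subspace_projection\<close> takes.\<close>

lemma linear_operator_subspace_dom: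
  assumes "linear_operator A"
  shows "subspace (dom A)"
proof (rule subspaceI)
  show "0 \<in> dom A" using assms by (simp add: linear_operator_def)
  show "x + y \<in> dom A" if "x \<in> dom A" "y \<in> dom A" for x y
    using assms that by (intro domI) (simp add: linear_operator_def)
  show "c *\<^sub>R x \<in> dom A" if "x \<in> dom A" for c x
    using assms that unfolding scaleR_eq_scaleC by (intro domI) (simp add: linear_operator_def)
qed

lemma linear_operator_zero:
  assumes "linear_operator A"
  shows "A 0 = Some 0"
proof -
  have "0 \<in> dom A" and add: "A (0 + 0) = Some (the (A 0) + the (A 0))"
    using assms unfolding linear_operator_def by blast+
  then obtain z where "A 0 = Some z" by blast
  with add show ?thesis by simp
qed

lemma linear_operator_subspace_graph:
  assumes "linear_operator A"
  shows "subspace (Map.graph A)"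
proof (rule subspaceI)
  show "0 \<in> Map.graph A"
    using linear_operator_zero[OF assms] by (simp add: Map.graph_def zero_prod_def)
  show "p + q \<in> Map.graph A" if "p \<in> Map.graph A" "q \<in> Map.graph A" for p q
  proof -
    have p: "A (fst p) = Some (snd p)" "A (fst q) = Some (snd q)"
      using that by (auto simp: Map.graph_def)
    then have "A (fst p + fst q) = Some (the (A (fst p)) + the (A (fst q)))"
      using assms unfolding linear_operator_def by blast
    then show ?thesis using p by (auto simp: Map.graph_def plus_prod_def)
  qed
  show "c *\<^sub>R p \<in> Map.graph A" if "p \<in> Map.graph A" for c p
  proof -
    have p: "A (fst p) = Some (snd p)" using that by (auto simp: Map.graph_def)
    then have "A (c *\<^sub>R fst p) = Some (c *\<^sub>R the (A (fst p)))"
      using assms unfolding linear_operator_def scaleR_eq_scaleC by blast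
    then show ?thesis using p by (auto simp: Map.graph_def scaleR_prod_def)
  qed
qed

lemma densely_defined_op_adjoint:
  fixes A :: "'a::separable_chilbert_space \<rightharpoonup> 'a"
  assumes A: "linear_operator A" "densely_defined A" "closed_operator A"
  shows "densely_defined (op_adjoint A)"
proof -
  have trivial_complement: "x = 0" if x: "\<And>y. y \<in> dom (op_adjoint A) \<Longrightarrow> inner x y = 0" for x
  proof -
    obtain p where p: "p \<in> Map.graph A"
      "\<And>s. s \<in> Map.graph A \<Longrightarrow> inner ((0, x) - p) s = 0"
      using closed_subspace_projection[of "Map.graph A" "(0, x)"]
        linear_operator_subspace_graph[OF A(1)] A(3)
      by (auto simp: closed_operator_def)
    \<comment> \<open>The pair of \<open>u\<close> and \<open>v\<close> is the residual of
      \<open>(0, x)\<close> after projection onto the graph.\<close>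
    define u v where "u = fst ((0, x) - p)" and "v = snd ((0, x) - p)"
    have re: "inner u y + inner v (the (A y)) = 0" if "y \<in> dom A" for y
      using p(2)[of "(y, the (A y))"] that
      by (auto simp: Map.graph_def u_def v_def inner_prod_def)
    have "cinner u y + cinner v (the (A y)) = 0" if y: "y \<in> dom A" for y
    proof -
      \<comment> \<open>The projection gives only real orthogonality. Since the graph is invariant
        under multiplication by \<open>- \<i>\<close>, testing with the rotated pair supplies the
        imaginary part.\<close>
      have "A ((- \<i>) *\<^sub>C y) = Some ((- \<i>) *\<^sub>C the (A y))"
        using A(1) y by (simp add: linear_operator_def)
      then have "inner u ((- \<i>) *\<^sub>C y) + inner v ((- \<i>) *\<^sub>C the (A y)) = 0"
        using re[of "(- \<i>) *\<^sub>C y"] by auto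
      then show ?thesis
        using re[OF y] by (simp add: cinner_eq_inner complex_eq_iff)
    qed
    then have "op_adjoint A v = Some (- u)"
      by (simp add: op_adjoint_eq_Some_iff[OF A(2)] cinner_minus_left add_eq_0_iff)
    then have "inner x v = 0" using x by blast
    moreover have "inner ((0, x) - p) p = 0" using p by blast
    \<comment> \<open>The squared norm of the residual reduces to the inner product of
      \<open>v\<close> and \<open>x\<close>, which is zero because \<open>v\<close> is in the domain
      of the adjoint.\<close>
    moreover have "inner ((0, x) - p) ((0, x) - p) =
        inner ((0, x) - p) (0, x) - inner ((0, x) - p) p"
      by (rule inner_diff_right)
    ultimately have "inner ((0, x) - p) ((0, x) - p) = 0"
      by (simp add: v_def inner_prod_def inner_commute)
    then have "p = (0, x)" by simp
    then have "A 0 = Some x" using p(1) by (simp add: Map.graph_def)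
    then show ?thesis using linear_operator_zero[OF A(1)] by simp
  qed
  have sub: "subspace (closure (dom (op_adjoint A)))"
    using A(2) by (intro subspace_closure linear_operator_subspace_dom linear_operator_op_adjoint)
  have "x \<in> closure (dom (op_adjoint A))" for x
  proof -
    obtain p where p: "p \<in> closure (dom (op_adjoint A))"
      "\<And>s. s \<in> closure (dom (op_adjoint A)) \<Longrightarrow> inner (x - p) s = 0"
      using closed_subspace_projection[OF closed_closure sub] by blast
    then have "x - p = 0" by (meson trivial_complement closure_subset subsetD)
    then show ?thesis using p by simp
  qed
  then show ?thesis by (auto simp: densely_defined_def)
qed

section \<open>Measurability\<close>

text \<open>Weak measurability concerns pairings with a fixed vector. For two varying vectors,
  separability first upgrades both families to Borel measurability; then continuity of the real
  inner product applies to real and imaginary parts.\<close>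

lemma borel_measurable_cinner:
  fixes f g :: "real \<Rightarrow> 'a::separable_chilbert_space"
  assumes "weakly_measurable f" "weakly_measurable g"
  shows "(\<lambda>t. cinner (f t) (g t)) \<in> borel_measurable lebesgue"
proof -
  have [measurable]: "f \<in> borel_measurable lebesgue" "g \<in> borel_measurable lebesgue"
    "(\<lambda>t. (- \<i>) *\<^sub>C g t) \<in> borel_measurable lebesgue"
    using assms by (auto intro!: weakly_measurable_imp_measurable weakly_measurable_scaleC)
  show ?thesis unfolding cinner_eq_inner Complex_eq by measurable
qed

lemma square_integrable_rep_L2: "square_integrable (rep_L2 g)"
  using Quotient3_rep_reflp[OF Quotient3_L2] by blast

text \<open>This turns convergence in \<open>L2\<close> into convergence in mean of the squared
  pointwise distances.\<close>

lemma power2_dist_L2: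
  assumes "square_integrable u"
  shows "(dist g (abs_L2 u))\<^sup>2 = (\<integral>t. (norm (rep_L2 g t - u t))\<^sup>2 \<partial>lebesgue)"
proof -
  have d: "square_integrable (\<lambda>t. rep_L2 g t - u t)"
    by (intro square_integrable_diff square_integrable_rep_L2 assms)
  have "g - abs_L2 u = abs_L2 (\<lambda>t. rep_L2 g t - u t)"
    using minus_L2.abs_eq[of "rep_L2 g" u] assms square_integrable_rep_L2[of g]
    by (simp add: Quotient3_abs_rep[OF Quotient3_L2])
  then show ?thesis
    using d by (simp add: dist_norm power2_norm_eq_inner inner_L2.abs_eq)
qed

text \<open>Nonnegative functions whose integrals tend to zero have a subsequence tending to zero
  almost everywhere, here applied to squared pointwise distances.\<close>

lemma dense_L2_AE_sequence:
  fixes u :: "real \<Rightarrow> 'a::separable_chilbert_space"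
  assumes X: "closure X = (UNIV :: 'a L2 set)" and u: "square_integrable u"
  obtains g where "\<And>k. g k \<in> X" "AE t in lebesgue. (\<lambda>k. rep_L2 (g k) t) \<longlonglongrightarrow> u t"
proof -
  have "abs_L2 u \<in> closure X" using X by simp
  then obtain g where g: "\<And>k. g k \<in> X" "g \<longlonglongrightarrow> abs_L2 u"
    unfolding closure_sequential by blast
  have "(\<lambda>k. (dist (g k) (abs_L2 u))\<^sup>2) \<longlonglongrightarrow> 0\<^sup>2"
    using g(2) by (intro tendsto_power) (simp add: tendsto_dist_iff[symmetric])
  then have "(\<lambda>k. \<integral>t. norm ((norm (rep_L2 (g k) t - u t))\<^sup>2) \<partial>lebesgue) \<longlonglongrightarrow> 0"
    by (simp add: power2_dist_L2[OF u])
  moreover have "integrable lebesgue (\<lambda>t. (norm (rep_L2 (g k) t - u t))\<^sup>2)" for k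
    using square_integrable_diff[OF square_integrable_rep_L2 u]
    by (simp add: square_integrable_def)
  ultimately obtain r where r: "strict_mono r"
    "AE t in lebesgue. (\<lambda>k. (norm (rep_L2 (g (r k)) t - u t))\<^sup>2) \<longlonglongrightarrow> 0"
    using tendsto_L1_AE_subseq[of lebesgue "\<lambda>k t. (norm (rep_L2 (g k) t - u t))\<^sup>2"] by blast
  have "AE t in lebesgue. (\<lambda>k. rep_L2 (g (r k)) t) \<longlonglongrightarrow> u t"
    using r(2)
  proof (rule AE_mp, intro AE_I2 impI)
    fix t assume "(\<lambda>k. (norm (rep_L2 (g (r k)) t - u t))\<^sup>2) \<longlonglongrightarrow> 0"
    from tendsto_real_sqrt[OF this] show "(\<lambda>k. rep_L2 (g (r k)) t) \<longlonglongrightarrow> u t"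
      by (simp add: tendsto_norm_zero_iff LIM_zero_iff)
  qed
  with g(1) show thesis by (intro that[of "g \<circ> r"]) auto
qed

text \<open>A nonzero constant is not square integrable on the whole line, so \<open>h\<close> is
  cut off to a bounded interval before it is approximated.\<close>

lemma square_integrable_indicator:
  "square_integrable (\<lambda>t. indicator {- real n..real n} t *\<^sub>R h)"
proof -
  have "weakly_measurable (\<lambda>t. indicator {- real n..real n} t *\<^sub>R h)"
    unfolding weakly_measurable_def scaleR_eq_scaleC cinner_scaleC_right
    by (intro allI borel_measurable_times measurable_compose[OF _ borel_measurable_of_real]
        borel_measurable_indicator) auto
  moreover have "integrable lebesgue (\<lambda>t. indicator {- real n..real n} t * (norm h)\<^sup>2)"
    by (intro integrable_mult_left integrable_real_indicator) auto
  moreover have "(norm (indicator {- real n..real n} t *\<^sub>R h))\<^sup>2 =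
      indicator {- real n..real n} t * (norm h)\<^sup>2" for t
    by (simp add: indicator_def)
  ultimately show ?thesis by (simp add: square_integrable_def)
qed

text \<open>The total function \<open>lim\<close> is measurable whatever it returns at points of
  divergence. Completeness of Lebesgue measure passes this on to \<open>f\<close>, which differs
  from it only on a null set.\<close>

lemma borel_measurable_lebesgue_AE_limit:
  fixes f :: "real \<Rightarrow> complex"
  assumes F: "\<And>k. F k \<in> borel_measurable lebesgue"
    and lim: "AE t in lebesgue. (\<lambda>k. F k t) \<longlonglongrightarrow> f t"
  shows "f \<in> borel_measurable lebesgue"
proof -
  have "(\<lambda>t. lim (\<lambda>k. F k t)) \<in> borel_measurable lebesgue"
    using F by (rule borel_measurable_lim_metric)
  moreover have "AE t in lebesgue. lim (\<lambda>k. F k t) = f t"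
    using lim by (auto simp: limI)
  ultimately show ?thesis by (rule borel_measurable_AE)
qed

lemma weakly_measurable_op_adjoint:
  fixes T :: "real \<Rightarrow> 'h::separable_chilbert_space \<rightharpoonup> 'h"
  assumes T: "\<And>t. densely_defined (T t)" "densely_defined (maximal_operator T)"
    and f: "weakly_measurable f" "\<And>t. f t \<in> dom (op_adjoint (T t))"
  shows "weakly_measurable (\<lambda>t. the (op_adjoint (T t) (f t)))"
proof -
  define F where "F t = the (op_adjoint (T t) (f t))" for t
  have F: "cinner (F t) x = cinner (f t) (the (T t x))" if "x \<in> dom (T t)" for t x
    unfolding F_def using cinner_op_adjoint[OF T(1) f(2) that] .
  have local: "(\<lambda>t. cinner (F t) (indicator {- real n..real n} t *\<^sub>R h)) \<in> borel_measurable lebesgue"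
    for h and n :: nat
  proof -
    have "closure (dom (maximal_operator T)) = UNIV"
      using T(2) by (simp add: densely_defined_def)
    then obtain g where g: "\<And>k. g k \<in> dom (maximal_operator T)"
      "AE t in lebesgue. (\<lambda>k. rep_L2 (g k) t) \<longlonglongrightarrow> indicator {- real n..real n} t *\<^sub>R h"
      using dense_L2_AE_sequence[OF _ square_integrable_indicator] by metis
    have gT: "AE t in lebesgue. rep_L2 (g k) t \<in> dom (T t)"
      "square_integrable (\<lambda>t. the (T t (rep_L2 (g k) t)))" for k
      using g(1)[of k] by (auto simp: maximal_operator_def split: if_splits)
    show ?thesis
    proof (rule borel_measurable_lebesgue_AE_limit)
      \<comment> \<open>Here \<open>F\<close> no longer occurs: both arguments are known to be
        weakly measurable. Only pointwise pairings are taken, as \<open>f\<close> may fail to be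
        square integrable.\<close>
      show "(\<lambda>t. cinner (f t) (the (T t (rep_L2 (g k) t)))) \<in> borel_measurable lebesgue" for k
        using f(1) gT(2) by (intro borel_measurable_cinner) (auto simp: square_integrable_def)
      \<comment> \<open>The exceptional null sets for the countably many \<open>k\<close> are
        merged, so that the adjoint relation \<open>F\<close> holds along the whole sequence outside
        one null set.\<close>
      have "AE t in lebesgue. \<forall>k. rep_L2 (g k) t \<in> dom (T t)"
        using gT(1) by (simp add: AE_all_countable)
      with g(2) show "AE t in lebesgue. (\<lambda>k. cinner (f t) (the (T t (rep_L2 (g k) t))))
          \<longlonglongrightarrow> cinner (F t) (indicator {- real n..real n} t *\<^sub>R h)"
      proof eventually_elim
        case (elim t)
        have "(\<lambda>k. cinner (F t) (rep_L2 (g k) t))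
            \<longlonglongrightarrow> cinner (F t) (indicator {- real n..real n} t *\<^sub>R h)"
          using continuous_on_tendsto_compose[OF continuous_cinner_right[of UNIV] elim(1)] by simp
        then show ?case using elim(2) by (simp add: F)
      qed
    qed
  qed
  \<comment> \<open>The cutoff is now removed: at each \<open>t\<close> the truncated pairings are
    constant once \<open>n\<close> reaches the absolute value of \<open>t\<close>.\<close>
  have "(\<lambda>t. cinner (F t) h) \<in> borel_measurable lebesgue" for h
  proof (rule borel_measurable_lebesgue_AE_limit[OF local], rule AE_I2)
    fix t :: real
    obtain N :: nat where N: "\<bar>t\<bar> \<le> real N" using real_arch_simple by blast
    have "eventually (\<lambda>n. cinner (F t) (indicator {- real n..real n} t *\<^sub>R h) = cinner (F t) h)
        sequentially"
      using eventually_ge_at_top[of N] by eventually_elim (use N in \<open>auto simp: indicator_def\<close>)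
    then show "(\<lambda>n. cinner (F t) (indicator {- real n..real n} t *\<^sub>R h)) \<longlonglongrightarrow> cinner (F t) h"
      by (rule tendsto_eventually)
  qed
  \<comment> \<open>Conjugation moves \<open>h\<close> into the first slot, where
    \<open>weakly_measurable\<close> has it.\<close>
  then have "(\<lambda>t. cnj (cinner (F t) h)) \<in> borel_measurable lebesgue" for h
    by (rule measurable_compose) (simp add: borel_measurable_continuous_onI continuous_on_cnj)
  then show ?thesis
    unfolding weakly_measurable_def F_def by (subst cinner_commute) simp
qed

theorem lemma4p6:
  fixes T :: "real \<Rightarrow> 'h::separable_chilbert_space \<rightharpoonup> 'h"
  assumes "\<And>t. linear_operator (T t)"
    and "\<And>t. densely_defined (T t)"
    and "\<And>t. closed_operator (T t)"
    and "weakly_measurable_family T"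
    and "densely_defined (maximal_operator T)"
  shows "weakly_measurable_family (\<lambda>t. op_adjoint (T t))"
  \<comment> \<open>The definition bundles linearity, density and closedness of every member, so
    these are supplied for the adjoints along with measurability.\<close>
  using assms unfolding weakly_measurable_family_def
  by (simp add: linear_operator_op_adjoint densely_defined_op_adjoint closed_operator_op_adjoint
      weakly_measurable_op_adjoint)

end
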